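(* In every $4$-total coloring of a cubic graph of order $16$, the color class configuration is $(10,10,10,10)$ or $(11,10,10,9)$. Both configurations are attained by $4$-total colorings of the connected cubic graph $H_{16}$; in particular, $(11,10,10,9)$ is the unique configuration of a non-equitable $4$-total coloring of a cubic graph of order $16$.
   Context: All graphs are finite, simple and cubic ($3$-regular), not necessarily connected unless stated. The order of a graph is its number of vertices. A $4$-total coloring of $G$ assigns one of the four colors $1,2,3,4$ to each vertex and each edge of $G$ so that adjacent vertices receive distinct colors, adjacent edges (edges sharing an endpoint) receive distinct colors, and every vertex and edge that are incident receive distinct colors. The color class $c_i$ is the set of all vertices and edges of color $i$. The color class configuration of the coloring is the multiset $\{|c_1|,|c_2|,|c_3|,|c_4|\}$, written as a non-increasing sequence. The coloring is equitable if $\bigl||c_i|-|c_j|\bigr| \le 1$ for all $i,j \in \{1,2,3,4\}$, and non-equitable otherwise. The graph $H_{16}$ has vertex set $\{0,1,\ldots,15\}$ and edge set $\{(0,2), (0,8), (0,15), (1,7), (1,9), (1,12), (2,4), (2,13), (3,5), (3,7), (3,15), (4,10), (4,14), (5,8), (5,11), (6,7), (6,12), (6,13), (8,15), (9,11), (9,13), (10,12), (10,14), (11,14)\}$, where $(a,b)$ denotes the undirected edge joining $a$ and $b$. *)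

theory Defs
  imports Main "HOL-Library.Multiset"
begin

type_synonym 'a edge = "'a set"

definition simple_graph :: "'a set \<Rightarrow> 'a edge set \<Rightarrow> bool" where
  "simple_graph V E \<longleftrightarrow> finite V \<and> (\<forall>e\<in>E. e \<subseteq> V \<and> card e = 2)"

definition cubic_graph :: "'a set \<Rightarrow> 'a edge set \<Rightarrow> bool" where
  "cubic_graph V E \<longleftrightarrow> simple_graph V E \<and> (\<forall>v\<in>V. card {e\<in>E. v \<in> e} = 3)"

definition connected_graph :: "'a set \<Rightarrow> 'a edge set \<Rightarrow> bool" where
  "connected_graph V E \<longleftrightarrow> V \<noteq> {} \<and> (\<forall>u\<in>V. \<forall>v\<in>V. (u, v) \<in> {(x, y). {x, y} \<in> E}\<^sup>*)"

text \<open>A coloring is a function on the disjoint sum of vertices (\<open>Inl\<close>) and edges (\<open>Inr\<close>);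
  its values outside \<open>V <+> E\<close> are irrelevant. In a simple graph \<open>{u, v} \<in> E\<close> forces
  \<open>u \<noteq> v\<close>.\<close>

definition four_total_coloring :: "'a set \<Rightarrow> 'a edge set \<Rightarrow> ('a + 'a edge \<Rightarrow> nat) \<Rightarrow> bool" where
  "four_total_coloring V E f \<longleftrightarrow>
     (\<forall>x\<in>V <+> E. f x \<in> {1..4}) \<and>
     (\<forall>u\<in>V. \<forall>v\<in>V. {u, v} \<in> E \<longrightarrow> f (Inl u) \<noteq> f (Inl v)) \<and>
     (\<forall>d\<in>E. \<forall>e\<in>E. d \<noteq> e \<and> d \<inter> e \<noteq> {} \<longrightarrow> f (Inr d) \<noteq> f (Inr e)) \<and>
     (\<forall>v\<in>V. \<forall>e\<in>E. v \<in> e \<longrightarrow> f (Inl v) \<noteq> f (Inr e))"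

definition color_class ::
  "'a set \<Rightarrow> 'a edge set \<Rightarrow> ('a + 'a edge \<Rightarrow> nat) \<Rightarrow> nat \<Rightarrow> ('a + 'a edge) set" where
  "color_class V E f i = {x \<in> V <+> E. f x = i}"

definition color_class_configuration ::
  "'a set \<Rightarrow> 'a edge set \<Rightarrow> ('a + 'a edge \<Rightarrow> nat) \<Rightarrow> nat multiset" where
  "color_class_configuration V E f =
     {#card (color_class V E f 1), card (color_class V E f 2),
       card (color_class V E f 3), card (color_class V E f 4)#}"

definition equitable :: "'a set \<Rightarrow> 'a edge set \<Rightarrow> ('a + 'a edge \<Rightarrow> nat) \<Rightarrow> bool" where
  "equitable V E f \<longleftrightarrow>
     (\<forall>i\<in>{1..4}. \<forall>j\<in>{1..4}.
        \<bar>int (card (color_class V E f i)) - int (card (color_class V E f j))\<bar> \<le> 1)"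

definition H16_verts :: "nat set" where
  "H16_verts = {0..15}"

definition H16_edges :: "nat edge set" where
  "H16_edges =
     {{0,2}, {0,8}, {0,15}, {1,7}, {1,9}, {1,12}, {2,4}, {2,13}, {3,5}, {3,7}, {3,15},
      {4,10}, {4,14}, {5,8}, {5,11}, {6,7}, {6,12}, {6,13}, {8,15}, {9,11}, {9,13},
      {10,12}, {10,14}, {11,14}}"

end

theory Submission
  imports Defs
begin

text \<open>
  In a cubic graph every star \<open>{v} \<union> {e. v \<in> e}\<close> carries all four colors. Hence, if \<open>n\<^sub>i\<close> vertices
  have color \<open>i\<close>, the edges of color \<open>i\<close> perfectly match the remaining vertices, so
  \<open>n\<^sub>i + 2 e\<^sub>i = 16\<close> and \<open>|c\<^sub>i| = 8 + n\<^sub>i / 2\<close>. For distinct colors \<open>i, j, k, l\<close> the matching of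
  color \<open>k\<close> sends the vertices of color \<open>l\<close> injectively to vertices of color \<open>i\<close> or \<open>j\<close>, whence
  \<open>n\<^sub>l \<le> n\<^sub>i + n\<^sub>j\<close>. Together with \<open>n\<^sub>1 + n\<^sub>2 + n\<^sub>3 + n\<^sub>4 = 16\<close> these inequalities leave only the
  two configurations.
\<close>

section \<open>Vertices and edges of one color, and how their numbers determine each other\<close>

definition color_verts :: "'a set \<Rightarrow> ('a + 'a edge \<Rightarrow> nat) \<Rightarrow> nat \<Rightarrow> 'a set" where
  "color_verts V f i = {v \<in> V. f (Inl v) = i}"

definition color_edges :: "'a edge set \<Rightarrow> ('a + 'a edge \<Rightarrow> nat) \<Rightarrow> nat \<Rightarrow> 'a edge set" where
  "color_edges E f i = {e \<in> E. f (Inr e) = i}"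

lemma color_verts_subset: "color_verts V f i \<subseteq> V"
  by (auto simp: color_verts_def)

lemma color_class_eq: "color_class V E f i = color_verts V f i <+> color_edges E f i"
  by (auto simp: color_class_def color_verts_def color_edges_def)

lemma finite_edges: "simple_graph V E \<Longrightarrow> finite E"
  unfolding simple_graph_def by (meson PowI finite_Pow_iff finite_subset subsetI)

lemma card_color_class:
  assumes "simple_graph V E"
  shows "card (color_class V E f i) = card (color_verts V f i) + card (color_edges E f i)"
proof -
  have "finite V" "finite E"
    using assms finite_edges by (auto simp: simple_graph_def)
  then show ?thesis
    by (simp add: color_class_eq card_Plus color_verts_def color_edges_def)
qed

text \<open>Any two elements of a star conflict: its edges share \<open>v\<close>, and each of them
  is incident to \<open>v\<close>. So \<open>f\<close> is injective on four elements with values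
  among four colors, and hence hits every color. This is where degree exactly 3 enters.\<close>

lemma star_color_surj:
  assumes cub: "cubic_graph V E" and col: "four_total_coloring V E f"
    and v: "v \<in> V" and k: "k \<in> {1..4}"
  shows "f (Inl v) = k \<or> (\<exists>e\<in>color_edges E f k. v \<in> e)"
proof -
  let ?S = "{e \<in> E. v \<in> e}"
  let ?T = "insert (Inl v) (Inr ` ?S)"
  have "card ?S = 3"
    using cub v by (auto simp: cubic_graph_def)
  then have "finite ?S"
    by (metis card.infinite zero_neq_numeral)
  have inj: "inj_on f ?T"
    using col v unfolding four_total_coloring_def inj_on_def by (auto 0 4)
  have "card (Inr ` ?S :: ('a + 'a edge) set) = 3"
    using \<open>card ?S = 3\<close> by (simp add: card_image)
  then have "card ?T = 4"
    using \<open>finite ?S\<close> by (subst card_insert_disjoint) auto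
  then have "card (f ` ?T) = card {1..4::nat}"
    using card_image[OF inj] by (simp del: image_insert)
  moreover have "f ` ?T \<subseteq> {1..4}"
    using col v unfolding four_total_coloring_def by auto
  ultimately have "f ` ?T = {1..4}"
    by (intro card_subset_eq) auto
  then have "k \<in> f ` ?T"
    using k by blast
  then show ?thesis
    by (auto simp: color_edges_def)
qed

lemma color_edges_disjoint:
  assumes "four_total_coloring V E f"
    and "d \<in> color_edges E f i" "e \<in> color_edges E f i" "d \<noteq> e"
  shows "d \<inter> e = {}"
  using assms unfolding four_total_coloring_def color_edges_def by blast

text \<open>A vertex of color \<open>i\<close> cannot meet an edge of color \<open>i\<close>, while
  at any other vertex the color \<open>i\<close> must occur in the star and so on an edge.\<close>

lemma Union_color_edges:
  assumes cub: "cubic_graph V E" and col: "four_total_coloring V E f" and i: "i \<in> {1..4}"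
  shows "\<Union>(color_edges E f i) = V - color_verts V f i"
proof
  show "\<Union>(color_edges E f i) \<subseteq> V - color_verts V f i"
  proof clarify
    fix v e assume "e \<in> color_edges E f i" "v \<in> e"
    then have e: "e \<in> E" "f (Inr e) = i" "v \<in> e"
      by (auto simp: color_edges_def)
    then have "v \<in> V"
      using cub by (auto simp: cubic_graph_def simple_graph_def)
    moreover have "f (Inl v) \<noteq> i"
      using col e \<open>v \<in> V\<close> by (auto simp: four_total_coloring_def)
    ultimately show "v \<in> V - color_verts V f i"
      by (simp add: color_verts_def)
  qed
  show "V - color_verts V f i \<subseteq> \<Union>(color_edges E f i)"
    using star_color_surj[OF cub col _ i] by (auto simp: color_verts_def)
qed

lemma card_color_verts_edges:
  assumes cub: "cubic_graph V E" and col: "four_total_coloring V E f" and i: "i \<in> {1..4}"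
  shows "card (color_verts V f i) + 2 * card (color_edges E f i) = card V"
proof -
  have V: "finite V" and E: "\<forall>e\<in>E. e \<subseteq> V \<and> card e = 2"
    using cub by (auto simp: cubic_graph_def simple_graph_def)
  have "finite E"
    using cub finite_edges by (auto simp: cubic_graph_def)
  \<comment> \<open>The edges of color \<open>i\<close> are disjoint two-element blocks, so counting
    the vertices they cover doubles their number.\<close>
  have "2 * card (color_edges E f i) = card (\<Union>(color_edges E f i))"
  proof (rule card_partition)
    show "finite (color_edges E f i)"
      using \<open>finite E\<close> by (simp add: color_edges_def)
    show "finite (\<Union>(color_edges E f i))"
      using V by (simp add: Union_color_edges[OF assms])
    show "card e = 2" if "e \<in> color_edges E f i" for e
      using that E by (auto simp: color_edges_def)
  qed (use color_edges_disjoint[OF col] in blast)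
  also have "\<dots> = card V - card (color_verts V f i)"
    using V by (simp add: Union_color_edges[OF assms] card_Diff_subset color_verts_subset
        finite_subset[OF color_verts_subset])
  finally show ?thesis
    \<comment> \<open>The difference above is truncated subtraction on naturals; the bound by
      \<open>card V\<close> turns it into the additive equation.\<close>
    using card_mono[OF V color_verts_subset, of f i] by linarith
qed

lemma card_V_eq_sum:
  assumes "finite V" "four_total_coloring V E f"
  shows "card V = (\<Sum>i\<in>{1..4}. card (color_verts V f i))"
proof -
  have "V = (\<Union>i\<in>{1..4}. color_verts V f i)"
    using assms(2) unfolding four_total_coloring_def color_verts_def by auto
  then have "card V = card (\<Union>i\<in>{1..4}. color_verts V f i)"
    by simp
  also have "\<dots> = (\<Sum>i\<in>{1..4}. card (color_verts V f i))"
    by (rule card_UN_disjoint) (use assms(1) in \<open>auto simp: color_verts_def\<close>)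
  finally show ?thesis .
qed

lemma card_color_verts_le:
  assumes cub: "cubic_graph V E" and col: "four_total_coloring V E f"
    and ijkl: "{i, j, k, l} = {1..4}" and "k \<noteq> l"
  shows "card (color_verts V f l) \<le> card (color_verts V f i) + card (color_verts V f j)"
proof -
  let ?W = "color_verts V f"
  have V: "finite V" and E: "\<forall>e\<in>E. e \<subseteq> V \<and> card e = 2"
    using cub by (auto simp: cubic_graph_def simple_graph_def)
  have k: "k \<in> {1..4}"
    using ijkl by blast
  \<comment> \<open>The witness is the other end of the edge of color \<open>k\<close> at
    \<open>v\<close>: its color differs from \<open>l\<close> by adjacency and from \<open>k\<close>
    by incidence, which leaves \<open>i\<close> and \<open>j\<close>.\<close>
  have "\<exists>w. {v, w} \<in> color_edges E f k \<and> w \<in> ?W i \<union> ?W j" if v: "v \<in> ?W l" for v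
  proof -
    have "v \<in> V" "f (Inl v) = l"
      using v by (auto simp: color_verts_def)
    then obtain e where e: "e \<in> color_edges E f k" "v \<in> e"
      using star_color_surj[OF cub col _ k] \<open>k \<noteq> l\<close> by metis
    then have "e \<in> E" "f (Inr e) = k" "card e = 2" "e \<subseteq> V"
      using E by (auto simp: color_edges_def)
    then obtain w where w: "e = {v, w}"
      using \<open>v \<in> e\<close> by (auto simp: card_2_iff doubleton_eq_iff)
    have "w \<in> V"
      using w \<open>e \<subseteq> V\<close> by blast
    have "f (Inl w) \<noteq> f (Inl v)"
      using col w \<open>w \<in> V\<close> \<open>v \<in> V\<close> \<open>e \<in> E\<close> unfolding four_total_coloring_def by metis
    moreover have "f (Inl w) \<noteq> f (Inr e)"
      using col w \<open>w \<in> V\<close> \<open>e \<in> E\<close> unfolding four_total_coloring_def by simp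
    moreover have "\<forall>x\<in>V <+> E. f x \<in> {1..4}"
      using col unfolding four_total_coloring_def by (rule conjunct1)
    then have "f (Inl w) \<in> {1..4}"
      using InlI[OF \<open>w \<in> V\<close>] by (rule bspec)
    ultimately have "f (Inl w) \<in> {i, j}"
      using ijkl \<open>f (Inr e) = k\<close> \<open>f (Inl v) = l\<close> by blast
    then have "w \<in> ?W i \<union> ?W j"
      using \<open>w \<in> V\<close> by (auto simp: color_verts_def)
    then show ?thesis
      using e w by blast
  qed
  then obtain p where p: "\<And>v. v \<in> ?W l \<Longrightarrow> {v, p v} \<in> color_edges E f k"
      "\<And>v. v \<in> ?W l \<Longrightarrow> p v \<in> ?W i \<union> ?W j"
    by metis
  \<comment> \<open>Equal partners would give two edges of color \<open>k\<close> with a common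
    vertex. Such edges coincide, and then their first ends agree as well.\<close>
  have "inj_on p (?W l)"
  proof (rule inj_onI)
    fix u v assume uv: "u \<in> ?W l" "v \<in> ?W l" "p u = p v"
    have "{u, p u} \<inter> {v, p v} \<noteq> {}"
      using uv by auto
    then have "{u, p u} = {v, p v}"
      using color_edges_disjoint[OF col p(1)[OF uv(1)] p(1)[OF uv(2)]] by blast
    then show "u = v"
      using uv by (metis doubleton_eq_iff)
  qed
  then have "card (?W l) = card (p ` ?W l)"
    by (simp add: card_image)
  also have "\<dots> \<le> card (?W i \<union> ?W j)"
    using p(2) V by (intro card_mono) (auto simp: color_verts_def)
  also have "\<dots> \<le> card (?W i) + card (?W j)"
    by (rule card_Un_le)
  finally show ?thesis .
qed

section \<open>From inequalities between class sizes to the two configurations\<close>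

lemma configuration_arith:
  fixes w x y z :: nat
  assumes "w + x + y + z = 40"
    and "w + 8 \<le> x + y" "w + 8 \<le> x + z" "w + 8 \<le> y + z"
    and "x + 8 \<le> w + y" "x + 8 \<le> w + z" "x + 8 \<le> y + z"
    and "y + 8 \<le> w + x" "y + 8 \<le> w + z" "y + 8 \<le> x + z"
    and "z + 8 \<le> w + x" "z + 8 \<le> w + y" "z + 8 \<le> x + y"
  shows "{#w, x, y, z#} = {#10, 10, 10, 10#} \<or> {#w, x, y, z#} = {#11, 10, 10, 9#}"
proof -
  \<comment> \<open>Adding \<open>x + 8 \<le> w + y\<close> and \<open>y + 8 \<le> w + x\<close>
    gives \<open>8 \<le> w\<close>. Adding the three bounds on \<open>w\<close> gives
    \<open>3 * w + 24 \<le> 2 * (40 - w)\<close>, so \<open>w \<le> 11\<close>. The other variables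
    are symmetric, and a finite check over \<open>w\<close>, \<open>x\<close>, \<open>y\<close>
    remains.\<close>
  have "8 \<le> w" "8 \<le> x" "8 \<le> y" "w \<le> 11" "x \<le> 11" "y \<le> 11"
    using assms by linarith+
  then have "w \<in> {8, 9, 10, 11}" "x \<in> {8, 9, 10, 11}" "y \<in> {8, 9, 10, 11}"
    by simp_all linarith+
  moreover have "z = 40 - w - x - y"
    using assms by linarith
  ultimately show ?thesis
    using assms(2-) by (elim insertE emptyE) (simp_all only:, simp_all)
qed

lemma configuration_cases:
  fixes V :: "'a set"
  assumes cub: "cubic_graph V E" and V: "card V = 16" and col: "four_total_coloring V E f"
  shows "color_class_configuration V E f = {#10, 10, 10, 10#} \<or>
         color_class_configuration V E f = {#11, 10, 10, 9#}"
proof -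
  let ?n = "\<lambda>i. card (color_verts V f i)"
  define c where "c = (\<lambda>i. card (color_class V E f i))"
  \<comment> \<open>With n vertices and e edges of color \<open>i\<close>, n + 2e = 16 and
    \<open>c i\<close> = n + e; eliminating e leaves this relation.\<close>
  have n: "?n i + 16 = 2 * c i" if "i \<in> {1..4}" for i
    using card_color_verts_edges[OF cub col that] card_color_class[of V E f i] cub V
    by (simp add: cubic_graph_def c_def)
  have "finite V"
    using cub by (simp add: cubic_graph_def simple_graph_def)
  from card_V_eq_sum[OF this col] have "?n 1 + ?n 2 + ?n 3 + ?n 4 = 16"
    using V by (simp add: eval_nat_numeral)
  then have sum: "c 1 + c 2 + c 3 + c 4 = 40"
    using n[of 1] n[of 2] n[of 3] n[of 4] by simp
  \<comment> \<open>Substituting n = 2c - 16 into the inequality for vertex counts and halving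
    produces the constant 8.\<close>
  have le: "c l + 8 \<le> c i + c j" if ijkl: "{i, j, k, l} = {1, 2, 3, 4}" "k \<noteq> l" for i j k l
  proof -
    have "{1..4} = {1, 2, 3, 4::nat}"
      by auto
    then have set: "{i, j, k, l} = {1..4}"
      by (simp only: ijkl(1))
    then have "i \<in> {1..4}" "j \<in> {1..4}" "l \<in> {1..4}"
      by blast+
    then show ?thesis
      using card_color_verts_le[OF cub col set \<open>k \<noteq> l\<close>] n[of i] n[of j] n[of l] by linarith
  qed
  have ineqs:
    "c 1 + 8 \<le> c 2 + c 3" "c 1 + 8 \<le> c 2 + c 4" "c 1 + 8 \<le> c 3 + c 4"
    "c 2 + 8 \<le> c 1 + c 3" "c 2 + 8 \<le> c 1 + c 4" "c 2 + 8 \<le> c 3 + c 4"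
    "c 3 + 8 \<le> c 1 + c 2" "c 3 + 8 \<le> c 1 + c 4" "c 3 + 8 \<le> c 2 + c 4"
    "c 4 + 8 \<le> c 1 + c 2" "c 4 + 8 \<le> c 1 + c 3" "c 4 + 8 \<le> c 2 + c 3"
    \<comment> \<open>The matching color \<open>k\<close> does not occur in the conclusion of
      \<open>le\<close>, so each instance is given explicitly.\<close>
    by (rule le[of 2 3 4 1] le[of 2 4 3 1] le[of 3 4 2 1]
        le[of 1 3 4 2] le[of 1 4 3 2] le[of 3 4 1 2]
        le[of 1 2 4 3] le[of 1 4 2 3] le[of 2 4 1 3]
        le[of 1 2 3 4] le[of 1 3 2 4] le[of 2 3 1 4]; simp add: insert_commute)+
  show ?thesis
    using configuration_arith[OF sum ineqs]
    unfolding color_class_configuration_def c_def .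
qed

text \<open>The multiset forgets which color has which size, but its underlying set is
  \<open>{m}\<close>, so all four sizes are \<open>m\<close>. Contraposition rules out (10,10,10,10)
  for non-equitable colorings.\<close>

lemma equitable_if_configuration:
  assumes "color_class_configuration V E f = {#m, m, m, m#}"
  shows "equitable V E f"
proof -
  let ?c = "\<lambda>i. card (color_class V E f i)"
  have "set_mset (color_class_configuration V E f) = {m}"
    using assms by simp
  then have "?c 1 = m" "?c 2 = m" "?c 3 = m" "?c 4 = m"
    by (auto simp: color_class_configuration_def)
  moreover have "{1..4} = {1, 2, 3, 4::nat}"
    by auto
  ultimately show ?thesis
    by (simp add: equitable_def)
qed

section \<open>The graph \<open>H16\<close>: connectedness and regularity\<close>

lemma connected_graph_if_path:
  assumes "vs \<noteq> []" "successively (\<lambda>u v. {u, v} \<in> E) vs"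
  shows "connected_graph (set vs) E"
proof -
  let ?R = "{(x, y). {x, y} \<in> E}"
  \<comment> \<open>Symmetry reduces connectedness to reaching every vertex from the head of the
    list: two vertices are then joined through the head.\<close>
  have "sym (?R\<^sup>*)"
    by (intro sym_rtrancl) (auto simp: sym_def insert_commute)
  have hd: "(hd vs, v) \<in> ?R\<^sup>*" if "v \<in> set vs" for v
    using assms(2) that
  proof (induction vs)
    case (Cons u vs)
    show ?case
    proof (cases "v = u")
      case False
      then have "v \<in> set vs" "vs \<noteq> []"
        using Cons.prems by auto
      then have "(u, hd vs) \<in> ?R" "(hd vs, v) \<in> ?R\<^sup>*"
        using Cons by (auto simp: successively_Cons)
      then show ?thesis
        by (simp add: converse_rtrancl_into_rtrancl)
    qed simp
  qed simp
  have "(u, v) \<in> ?R\<^sup>*" if "u \<in> set vs" "v \<in> set vs" for u v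
    using symD[OF \<open>sym (?R\<^sup>*)\<close> hd[OF that(1)]] hd[OF that(2)] by (rule rtrancl_trans)
  then show ?thesis
    using \<open>vs \<noteq> []\<close> by (simp add: connected_graph_def)
qed

text \<open>Used to evaluate stars and color classes of \<open>H16\<close> element by element from
  the explicit vertex and edge sets.\<close>

lemma Collect_mem_insert:
  "{x \<in> insert a A. P x} = {x \<in> A. P x} \<union> (if P a then {a} else {})"
  by auto

lemma Collect_mem_empty: "{x \<in> {}. P x} = {}"
  by simp

lemma H16_verts_eq: "H16_verts = {0,1,2,3,4,5,6,7,8,9,10,11,12,13,14,15}"
  unfolding H16_verts_def by code_simp

lemma card_H16_verts: "card H16_verts = 16"
  by (simp add: H16_verts_def)

lemma cubic_H16: "cubic_graph H16_verts H16_edges"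
proof -
  \<comment> \<open>One case per vertex: filtering leaves an explicit set of three edges, and
    comparing doubletons shows them distinct.\<close>
  have "card {e \<in> H16_edges. v \<in> e} = 3" if "v \<in> H16_verts" for v
    using that unfolding H16_verts_eq H16_edges_def Collect_mem_insert Collect_mem_empty
    apply (elim insertE emptyE)
    apply (hypsubst, simp, simp add: doubleton_eq_iff)+
    done
  moreover have "e \<subseteq> H16_verts \<and> card e = 2" if "e \<in> H16_edges" for e
    using that unfolding H16_verts_eq H16_edges_def by (elim insertE emptyE; simp)
  moreover have "finite H16_verts"
    by (simp add: H16_verts_def)
  ultimately show ?thesis
    by (simp add: cubic_graph_def simple_graph_def)
qed

lemma simple_H16: "simple_graph H16_verts H16_edges"
  using cubic_H16 by (simp add: cubic_graph_def)

lemma connected_H16: "connected_graph H16_verts H16_edges"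
proof -
  \<comment> \<open>A Hamiltonian path of \<open>H16\<close>.\<close>
  let ?vs = "[0, 2, 4, 10, 12, 1, 9, 13, 6, 7, 3, 15, 8, 5, 11, 14] :: nat list"
  have "set ?vs = H16_verts"
    unfolding H16_verts_def by code_simp
  moreover have "successively (\<lambda>u v. {u, v} \<in> H16_edges) ?vs"
    by (simp add: H16_edges_def doubleton_eq_iff)
  ultimately show ?thesis
    using connected_graph_if_path[of ?vs] by simp
qed

section \<open>Two explicit total colorings of \<open>H16\<close>\<close>

definition list_coloring ::
  "nat list \<Rightarrow> nat edge set \<Rightarrow> nat edge set \<Rightarrow> nat edge set \<Rightarrow> nat + nat edge \<Rightarrow> nat" where
  "list_coloring cs M\<^sub>1 M\<^sub>2 M\<^sub>3 = case_sum (\<lambda>v. cs ! v)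
     (\<lambda>e. if e \<in> M\<^sub>1 then 1 else if e \<in> M\<^sub>2 then 2 else if e \<in> M\<^sub>3 then 3 else 4)"

text \<open>Every color gets four vertices and six edges.\<close>

definition H16_coloring_equitable :: "nat + nat edge \<Rightarrow> nat" where
  "H16_coloring_equitable = list_coloring [1,3,2,1,1,4,2,4,2,4,4,2,1,3,3,3]
     {{1,9}, {2,13}, {5,11}, {6,7}, {8,15}, {10,14}}
     {{0,15}, {1,7}, {3,5}, {4,14}, {9,13}, {10,12}}
     {{0,2}, {3,7}, {4,10}, {5,8}, {6,12}, {9,11}}"

text \<open>Color 1 gets two vertices and seven edges, color 2 six vertices and five edges, and
  colors 3 and 4 four vertices and six edges each. The bound 6 \<le> 2 + 4 on vertex counts is
  attained.\<close>

definition H16_coloring_non_equitable :: "nat + nat edge \<Rightarrow> nat" where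
  "H16_coloring_non_equitable = list_coloring [1,3,2,2,1,4,3,4,2,2,4,3,2,4,2,3]
     {{1,12}, {2,13}, {3,5}, {6,7}, {8,15}, {9,11}, {10,14}}
     {{0,15}, {1,7}, {4,10}, {5,11}, {6,13}}
     {{0,2}, {3,7}, {4,14}, {5,8}, {9,13}, {10,12}}"

text \<open>Since \<open>disjnt\<close> is symmetric, one direction of each test suffices; used
  backwards, this proves an explicit edge set to be a matching.\<close>

lemma pairwise_disjnt_insertI:
  "pairwise disjnt A \<Longrightarrow> \<forall>b\<in>A. disjnt a b \<Longrightarrow> pairwise disjnt (insert a A)"
  by (auto simp: pairwise_insert disjnt_sym)

text \<open>Recasts the definition for evaluation: vertex conflicts are tested along each edge, and
  edge conflicts become disjointness within each color class, avoiding a run over all pairs of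
  edges.\<close>

lemma H16_coloringI:
  assumes "\<forall>v\<in>H16_verts. f (Inl v) \<in> {1..4}"
    and "\<forall>e\<in>H16_edges. f (Inr e) \<in> {1..4} \<and> (\<forall>u\<in>e. f (Inl u) \<noteq> f (Inr e) \<and>
          (\<forall>v\<in>e. u \<noteq> v \<longrightarrow> f (Inl u) \<noteq> f (Inl v)))"
    and "\<forall>i\<in>{1,2,3,4}. pairwise disjnt (color_edges H16_edges f i)"
  shows "four_total_coloring H16_verts H16_edges f"
proof -
  \<comment> \<open>The second assumption compares only distinct ends; edges have cardinality 2, so
    a pair \<open>{u, v}\<close> in the edge set is never a loop.\<close>
  have "u \<noteq> v" if "{u, v} \<in> H16_edges" for u v
    using that cubic_H16 by (force simp: cubic_graph_def simple_graph_def)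
  then have "\<forall>u\<in>H16_verts. \<forall>v\<in>H16_verts. {u, v} \<in> H16_edges \<longrightarrow> f (Inl u) \<noteq> f (Inl v)"
    using assms(2) by blast
  moreover have "f (Inr d) \<noteq> f (Inr e)"
    if de: "d \<in> H16_edges" "e \<in> H16_edges" "d \<noteq> e" "d \<inter> e \<noteq> {}" for d e
  proof
    assume "f (Inr d) = f (Inr e)"
    then have "d \<in> color_edges H16_edges f (f (Inr e))" "e \<in> color_edges H16_edges f (f (Inr e))"
      using de by (auto simp: color_edges_def)
    moreover have "f (Inr e) \<in> {1..4}"
      using assms(2) de by blast
    then have "f (Inr e) \<in> {1, 2, 3, 4}"
      by auto
    ultimately show False
      using assms(3) de by (meson disjnt_def pairwiseD)
  qed
  ultimately show ?thesis
    using assms(1,2) unfolding four_total_coloring_def by auto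
qed

lemma color_edges_equitable:
  "color_edges H16_edges H16_coloring_equitable 1 =
     {{1,9}, {2,13}, {5,11}, {6,7}, {8,15}, {10,14}}"
  "color_edges H16_edges H16_coloring_equitable 2 =
     {{0,15}, {1,7}, {3,5}, {4,14}, {9,13}, {10,12}}"
  "color_edges H16_edges H16_coloring_equitable 3 =
     {{0,2}, {3,7}, {4,10}, {5,8}, {6,12}, {9,11}}"
  "color_edges H16_edges H16_coloring_equitable 4 =
     {{0,8}, {1,12}, {2,4}, {3,15}, {6,13}, {11,14}}"
  unfolding color_edges_def H16_edges_def Collect_mem_insert Collect_mem_empty
    H16_coloring_equitable_def list_coloring_def
  by (simp_all add: doubleton_eq_iff)

lemma color_verts_equitable:
  "color_verts H16_verts H16_coloring_equitable 1 = {0, 3, 4, 12}"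
  "color_verts H16_verts H16_coloring_equitable 2 = {2, 6, 8, 11}"
  "color_verts H16_verts H16_coloring_equitable 3 = {1, 13, 14, 15}"
  "color_verts H16_verts H16_coloring_equitable 4 = {5, 7, 9, 10}"
  unfolding color_verts_def H16_verts_eq Collect_mem_insert Collect_mem_empty
    H16_coloring_equitable_def list_coloring_def
  by simp_all

lemma four_total_equitable: "four_total_coloring H16_verts H16_edges H16_coloring_equitable"
proof (rule H16_coloringI)
  show "\<forall>v\<in>H16_verts. H16_coloring_equitable (Inl v) \<in> {1..4}"
    by (simp add: H16_verts_eq H16_coloring_equitable_def list_coloring_def)
  show "\<forall>e\<in>H16_edges. H16_coloring_equitable (Inr e) \<in> {1..4} \<and>
      (\<forall>u\<in>e. H16_coloring_equitable (Inl u) \<noteq> H16_coloring_equitable (Inr e) \<and>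
        (\<forall>v\<in>e. u \<noteq> v \<longrightarrow> H16_coloring_equitable (Inl u) \<noteq> H16_coloring_equitable (Inl v)))"
    unfolding H16_edges_def ball_simps
    by (simp add: H16_coloring_equitable_def list_coloring_def doubleton_eq_iff)
  show "\<forall>i\<in>{1, 2, 3, 4}. pairwise disjnt (color_edges H16_edges H16_coloring_equitable i)"
    \<comment> \<open>The color classes are first replaced by their explicit edge sets, so that only
      disjointness of doubletons is left to test.\<close>
    by (simp only: ball_simps simp_thms color_edges_equitable) (simp add: pairwise_disjnt_insertI)
qed

lemma card_color_class_equitable:
  "card (color_class H16_verts H16_edges H16_coloring_equitable 1) = 10"
  "card (color_class H16_verts H16_edges H16_coloring_equitable 2) = 10"
  "card (color_class H16_verts H16_edges H16_coloring_equitable 3) = 10"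
  "card (color_class H16_verts H16_edges H16_coloring_equitable 4) = 10"
  unfolding card_color_class[OF simple_H16] color_verts_equitable color_edges_equitable
  by (simp_all add: doubleton_eq_iff)

lemma configuration_equitable:
  "color_class_configuration H16_verts H16_edges H16_coloring_equitable = {#10, 10, 10, 10#}"
  unfolding color_class_configuration_def card_color_class_equitable
  by (simp add: add_mset_commute)

lemma color_edges_non_equitable:
  "color_edges H16_edges H16_coloring_non_equitable 1 =
     {{1,12}, {2,13}, {3,5}, {6,7}, {8,15}, {9,11}, {10,14}}"
  "color_edges H16_edges H16_coloring_non_equitable 2 =
     {{0,15}, {1,7}, {4,10}, {5,11}, {6,13}}"
  "color_edges H16_edges H16_coloring_non_equitable 3 =
     {{0,2}, {3,7}, {4,14}, {5,8}, {9,13}, {10,12}}"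
  "color_edges H16_edges H16_coloring_non_equitable 4 =
     {{0,8}, {1,9}, {2,4}, {3,15}, {6,12}, {11,14}}"
  unfolding color_edges_def H16_edges_def Collect_mem_insert Collect_mem_empty
    H16_coloring_non_equitable_def list_coloring_def
  by (simp_all add: doubleton_eq_iff)

lemma color_verts_non_equitable:
  "color_verts H16_verts H16_coloring_non_equitable 1 = {0, 4}"
  "color_verts H16_verts H16_coloring_non_equitable 2 = {2, 3, 8, 9, 12, 14}"
  "color_verts H16_verts H16_coloring_non_equitable 3 = {1, 6, 11, 15}"
  "color_verts H16_verts H16_coloring_non_equitable 4 = {5, 7, 10, 13}"
  unfolding color_verts_def H16_verts_eq Collect_mem_insert Collect_mem_empty
    H16_coloring_non_equitable_def list_coloring_def
  by simp_all

lemma four_total_non_equitable: "four_total_coloring H16_verts H16_edges H16_coloring_non_equitable"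
proof (rule H16_coloringI)
  show "\<forall>v\<in>H16_verts. H16_coloring_non_equitable (Inl v) \<in> {1..4}"
    by (simp add: H16_verts_eq H16_coloring_non_equitable_def list_coloring_def)
  show "\<forall>e\<in>H16_edges. H16_coloring_non_equitable (Inr e) \<in> {1..4} \<and>
      (\<forall>u\<in>e. H16_coloring_non_equitable (Inl u) \<noteq> H16_coloring_non_equitable (Inr e) \<and>
        (\<forall>v\<in>e. u \<noteq> v \<longrightarrow> H16_coloring_non_equitable (Inl u) \<noteq> H16_coloring_non_equitable (Inl v)))"
    unfolding H16_edges_def ball_simps
    by (simp add: H16_coloring_non_equitable_def list_coloring_def doubleton_eq_iff)
  show "\<forall>i\<in>{1, 2, 3, 4}. pairwise disjnt (color_edges H16_edges H16_coloring_non_equitable i)"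
    by (simp only: ball_simps simp_thms color_edges_non_equitable) (simp add: pairwise_disjnt_insertI)
qed

lemma card_color_class_non_equitable:
  "card (color_class H16_verts H16_edges H16_coloring_non_equitable 1) = 9"
  "card (color_class H16_verts H16_edges H16_coloring_non_equitable 2) = 11"
  "card (color_class H16_verts H16_edges H16_coloring_non_equitable 3) = 10"
  "card (color_class H16_verts H16_edges H16_coloring_non_equitable 4) = 10"
  unfolding card_color_class[OF simple_H16] color_verts_non_equitable color_edges_non_equitable
  by (simp_all add: doubleton_eq_iff)

lemma configuration_non_equitable:
  "color_class_configuration H16_verts H16_edges H16_coloring_non_equitable = {#11, 10, 10, 9#}"
  unfolding color_class_configuration_def card_color_class_non_equitable
  \<comment> \<open>The sizes arrive in the order of the colors, 9, 11, 10, 10, and have to be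
    permuted.\<close>
  by (simp add: add_mset_commute)

lemma not_equitable: "\<not> equitable H16_verts H16_edges H16_coloring_non_equitable"
proof
  assume "equitable H16_verts H16_edges H16_coloring_non_equitable"
  \<comment> \<open>Colors 1 and 2 are the smallest and the largest class, with sizes 9 and
    11.\<close>
  then have "\<bar>int (card (color_class H16_verts H16_edges H16_coloring_non_equitable 1)) -
      int (card (color_class H16_verts H16_edges H16_coloring_non_equitable 2))\<bar> \<le> 1"
    by (simp add: equitable_def)
  then show False
    unfolding card_color_class_non_equitable by simp
qed

theorem theorem5p3:
  shows "(\<forall>(V :: 'a set) E f.
            cubic_graph V E \<and> card V = 16 \<and> four_total_coloring V E f \<longrightarrow>
            color_class_configuration V E f = {#10, 10, 10, 10#} \<or>
            color_class_configuration V E f = {#11, 10, 10, 9#})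
       \<and> (cubic_graph H16_verts H16_edges \<and> card H16_verts = 16 \<and>
          connected_graph H16_verts H16_edges)
       \<and> (\<exists>f. four_total_coloring H16_verts H16_edges f \<and>
              color_class_configuration H16_verts H16_edges f = {#10, 10, 10, 10#})
       \<and> (\<exists>f. four_total_coloring H16_verts H16_edges f \<and>
              color_class_configuration H16_verts H16_edges f = {#11, 10, 10, 9#})
       \<and> (\<forall>(V :: 'a set) E f.
            cubic_graph V E \<and> card V = 16 \<and> four_total_coloring V E f \<and> \<not> equitable V E f \<longrightarrow>
            color_class_configuration V E f = {#11, 10, 10, 9#})
       \<and> (\<exists>f. four_total_coloring H16_verts H16_edges f \<and> \<not> equitable H16_verts H16_edges f \<and>
              color_class_configuration H16_verts H16_edges f = {#11, 10, 10, 9#})"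
  using configuration_cases equitable_if_configuration cubic_H16 card_H16_verts connected_H16
    four_total_equitable configuration_equitable
    four_total_non_equitable configuration_non_equitable not_equitable
  by blast

end
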